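(* Let $V=\{1,\dots,n\}$ and let $\mathcal{W}\subseteq\mathbb{R}^{n\times n}_+$ be a set of symmetric entrywise nonnegative matrices. Let $$\mathrm{Val(RP)}=\tfrac12\max_{y\in\{-1,1\}^{n}}\min_{W\in\mathcal{W}}\sum_{i<j}w_{ij}(1-y_iy_j).$$ Consider the following randomized algorithm. (1) Compute an optimal solution $\hat Y$ of $$\max_{Y\succeq0,\ Y_{ii}=1\ \forall i}\ \min_{W\in\mathcal{W}}\ \tfrac14\langle W,\mathbf{1}-Y\rangle$$ (with $\mathbf{1}$ the all-ones matrix and $\langle A,B\rangle=\sum_{i,j}A_{ij}B_{ij}$), together with a worst-case weight matrix $\hat W\in\arg\min_{W\in\mathcal{W}}\langle W,\mathbf{1}-\hat Y\rangle$. (2) Factor $\hat Y=U^TU$ (Cholesky) and let $\hat u_i\in S_n$ be the $i$-th column of $U$, so $\hat u_i\cdot\hat u_j=\hat Y_{ij}$. (3) Draw $r$ uniformly at random from the unit sphere $S_n=\{u\in\mathbb{R}^n:\|u\|=1\}$. (4) For each $i\in V$ set $\hat y_i=1$ if $\hat u_i\cdot r\ge0$ and $\hat y_i=-1$ otherwise. For $W\in\mathcal{W}$ let $\hat C(W)=\sum_{i<j}w_{ij}\frac{1-\hat y_i\hat y_j}{2}$, and let expectations be over $r$. Then $$\mathbb{E}[\hat C(W)]\ \ge\ 0.878\cdot\mathrm{Val(RP)}\quad\text{for all }W\in\mathcal{W};$$ in particular $\mathbb{E}[\hat C(\hat W)]\ge0.878\cdot\mathrm{Val(RP)}$. Moreover,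 $\mathrm{Val(RP)}\ge\mathbb{E}[\hat C(\hat W')]$, where $\hat W'\in\arg\min_{W\in\mathcal{W}}\sum_{i<j}w_{ij}\frac{1-\hat y_i\hat y_j}{2}$.
   Context: This is the Goemans–Williamson randomized rounding algorithm applied to the robust max-cut problem, where edge weights are uncertain and range over $\mathcal{W}$. Standing assumptions: the robust problems are well-posed with finite optimal values, inner minimizations attain their minima, and expectations are well-defined. *)

theory Defs
  imports "HOL-Probability.Probability"
begin

definition psd :: "real^'n^'n \<Rightarrow> bool" where
  "psd A \<longleftrightarrow> transpose A = A \<and> (\<forall>x. 0 \<le> x \<bullet> (A *v x))"

definition ones_mat :: "real^'n^'n" where
  "ones_mat = (\<chi> i j. 1)"

definition sign_vectors :: "(real^'n) set" where
  "sign_vectors = {y. \<forall>i. y $ i \<in> {-1, 1}}"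

definition sdp_feasible :: "(real^'n^'n) set" where
  "sdp_feasible = {Y. psd Y \<and> (\<forall>i. Y $ i $ i = 1)}"

text \<open>
  The vertex set \<open>{1, \<dots>, n}\<close> is a finite linearly ordered index type.
\<close>

definition cut_value :: "real^'n::{finite,wellorder}^'n::{finite,wellorder} \<Rightarrow> real^'n::{finite,wellorder} \<Rightarrow> real" where
  "cut_value W y = (\<Sum>(i, j)\<in>{(i, j). i < j}. W $ i $ j * ((1 - y $ i * y $ j) / 2))"

text \<open>
  The infima below are minima whenever the inner problem attains its minimum.  The inner product
  on \<^typ>\<open>real^'n^'n\<close> is the entrywise one.
\<close>

definition val_RP :: "(real^'n::{finite,wellorder}^'n::{finite,wellorder}) set \<Rightarrow> real" where
  "val_RP \<W> = 1/2 * Max ((\<lambda>y. INF W\<in>\<W>. \<Sum>(i, j)\<in>{(i, j). i < j}. W $ i $ j * (1 - y $ i * y $ j))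
                        ` sign_vectors)"

definition sdp_objective :: "(real^'n^'n) set \<Rightarrow> real^'n^'n \<Rightarrow> real" where
  "sdp_objective \<W> Y = (INF W\<in>\<W>. 1/4 * (W \<bullet> (ones_mat - Y)))"

text \<open>
  The uniform distribution on the unit sphere (normalised surface measure) is the law of
  \<open>x / norm x\<close> for \<open>x\<close> uniform in the unit ball; the null event \<open>x = 0\<close>, where
  \<^term>\<open>sgn x = 0\<close>, is cut off by restricting to the sphere.  Lemmas
  \<open>prob_space_uniform_sphere\<close> and \<open>uniform_sphere_orthogonal_invariant\<close> confirm that it is a
  rotation invariant probability measure on the sphere.
\<close>

definition uniform_sphere :: "'a::euclidean_space measure" where
  "uniform_sphere =
     restrict_space (distr (uniform_measure lborel (ball 0 1)) borel sgn) (sphere 0 1)"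

definition gw_round :: "real^'n^'n \<Rightarrow> real^'n \<Rightarrow> real^'n" where
  "gw_round U r = (\<chi> i. if column i U \<bullet> r \<ge> 0 then 1 else -1)"

lemma sgn_borel_measurable [measurable]: "sgn \<in> borel \<rightarrow>\<^sub>M (borel :: 'a::euclidean_space measure)"
  unfolding sgn_div_norm[abs_def] by measurable

lemma sets_uniform_sphere: "sets uniform_sphere = sets (restrict_space borel (sphere 0 1))"
  unfolding uniform_sphere_def by (rule sets_restrict_space_cong) simp

lemma space_uniform_sphere: "space uniform_sphere = sphere 0 1"
  unfolding uniform_sphere_def by (simp add: space_restrict_space)

lemma emeasure_uniform_sphere:
  fixes A :: "'a::euclidean_space set"
  assumes "A \<in> sets borel" "A \<subseteq> sphere 0 1"
  shows "emeasure uniform_sphere A =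
    emeasure lborel (ball 0 1 \<inter> sgn -` A) / emeasure lborel (ball 0 1 :: 'a set)"
proof -
  have *: "sgn -` A \<in> sets borel"
    using measurable_sets[OF sgn_borel_measurable assms(1)] by simp
  show ?thesis
    unfolding uniform_sphere_def using assms *
    by (simp add: emeasure_restrict_space emeasure_distr)
qed

lemma prob_space_uniform_sphere: "prob_space (uniform_sphere :: 'a::euclidean_space measure)"
proof (rule prob_spaceI)
  have "sgn -` sphere 0 1 = - {0::'a}"
    by (auto simp: norm_sgn)
  hence "emeasure lborel (ball 0 1 \<inter> sgn -` sphere 0 1 :: 'a set) = emeasure lborel (ball 0 1 - {0::'a})"
    by (simp add: Diff_eq)
  also have "\<dots> = emeasure lborel (ball 0 1 :: 'a set)"
    by (rule emeasure_Diff_null_set) (auto simp: null_sets_def)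
  moreover have "emeasure lborel (ball 0 1 :: 'a set) \<noteq> 0"
    using content_ball_pos[of 1 "0::'a"] by (auto simp: measure_def)
  moreover have "emeasure lborel (ball 0 1 :: 'a set) \<noteq> \<top>"
    using emeasure_lborel_ball_finite[of "0::'a" 1] by (simp del: emeasure_ball)
  ultimately show "emeasure uniform_sphere (space uniform_sphere :: 'a set) = 1"
    by (simp add: space_uniform_sphere emeasure_uniform_sphere top.not_eq_extremum del: emeasure_ball)
qed

lemma uniform_sphere_orthogonal_invariant:
  fixes f :: "real^'n::{finite,wellorder} \<Rightarrow> real^'n::{finite,wellorder}"
  assumes f: "orthogonal_transformation f"
    and A: "A \<in> sets borel" "A \<subseteq> sphere 0 1"
  shows "emeasure uniform_sphere (f ` A) = emeasure uniform_sphere A"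
proof -
  have bor: "ball 0 1 \<inter> sgn -` B \<in> sets borel" if "B \<in> sets borel" for B :: "(real^'n::{finite,wellorder}) set"
    using measurable_sets[OF sgn_borel_measurable that] by simp
  have lm: "ball 0 1 \<inter> sgn -` B \<in> lmeasurable" if "B \<in> sets borel" for B :: "(real^'n::{finite,wellorder}) set"
    using bor[OF that] by (intro bounded_set_imp_lmeasurable) (auto intro: bounded_subset[OF bounded_ball])
  have em: "emeasure lborel (ball 0 1 \<inter> sgn -` B) = ennreal (measure lebesgue (ball 0 1 \<inter> sgn -` B))"
    if "B \<in> sets borel" for B :: "(real^'n::{finite,wellorder}) set"
    using emeasure_eq_measure2[OF lm[OF that]] bor[OF that] by simp
  have bij: "bij f" and lin: "linear f" and nrm: "\<And>x. norm (f x) = norm x"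
    using f by (auto simp: orthogonal_transformation_bij orthogonal_transformation_linear
        orthogonal_transformation_norm)
  have inv: "orthogonal_transformation (inv f)"
    using f by (rule orthogonal_transformation_inv)
  have "f ` A = inv f -` A"
    using bij by (simp add: bij_vimage_eq_inv_image bij_imp_bij_inv inv_inv_eq)
  moreover have "inv f \<in> borel \<rightarrow>\<^sub>M borel"
    using orthogonal_transformation_linear[OF inv]
    by (intro borel_measurable_continuous_onI linear_continuous_on) (simp add: linear_conv_bounded_linear)
  ultimately have fA: "f ` A \<in> sets borel"
    using measurable_sets[of "inv f" borel borel A] A by simp
  have sgn_f: "sgn (f x) = f (sgn x)" for x
    by (simp add: sgn_div_norm nrm linear_cmul[OF lin])
  have "ball 0 1 \<inter> sgn -` (f ` A) = f ` (ball 0 1 \<inter> sgn -` A)"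
  proof (intro set_eqI iffI)
    fix y assume y: "y \<in> ball 0 1 \<inter> sgn -` (f ` A)"
    obtain x where x: "y = f x" using bij by (metis bij_pointE)
    with y sgn_f bij have "x \<in> ball 0 1 \<inter> sgn -` A"
      by (auto simp: nrm bij_is_inj inj_image_mem_iff)
    with x show "y \<in> f ` (ball 0 1 \<inter> sgn -` A)" by blast
  qed (auto simp: nrm sgn_f)
  moreover have "f ` A \<subseteq> sphere 0 1" using A by (auto simp: nrm)
  ultimately show ?thesis
    using measure_orthogonal_image[OF f lm[OF A(1)]] em[OF fA] em[OF A(1)]
    by (simp only: emeasure_uniform_sphere[OF fA] emeasure_uniform_sphere[OF A])
qed

lemma finite_sign_vectors: "finite (sign_vectors :: (real^'n) set)"
proof -
  have "finite {f :: 'n \<Rightarrow> real. \<forall>i. f i \<in> {-1,1}}"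
    using finite_PiE[of "UNIV :: 'n set" "\<lambda>_. {-1,1::real}"]
    by (simp add: PiE_UNIV_domain Pi_def)
  moreover have "sign_vectors \<subseteq> vec_lambda ` {f :: 'n \<Rightarrow> real. \<forall>i. f i \<in> {-1,1}}"
  proof
    fix y :: "real^'n" assume "y \<in> sign_vectors"
    hence "y = vec_lambda (vec_nth y)" "vec_nth y \<in> {f. \<forall>i. f i \<in> {-1,1}}"
      by (auto simp: sign_vectors_def)
    thus "y \<in> vec_lambda ` {f. \<forall>i. f i \<in> {-1,1}}" by (rule image_eqI)
  qed
  ultimately show ?thesis by (rule finite_surj)
qed

lemma gw_round_in_sign_vectors: "gw_round U r \<in> sign_vectors"
  by (simp add: gw_round_def sign_vectors_def)

lemma integrable_gw_round:
  fixes g :: "real^'n \<Rightarrow> real"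
  shows "integrable uniform_sphere (\<lambda>r. g (gw_round U r))"
proof -
  interpret prob_space "uniform_sphere :: (real^'n) measure"
    by (rule prob_space_uniform_sphere)
  have eq: "g (gw_round U r) =
      (\<Sum>y\<in>sign_vectors. g y * indicator {r. \<forall>i. (y $ i = 1) = (0 \<le> column i U \<bullet> r)} r)" for r
  proof -
    have "(\<forall>i. (y $ i = 1) = (0 \<le> column i U \<bullet> r)) \<longleftrightarrow> y = gw_round U r" if "y \<in> sign_vectors" for y
    proof -
      have "y $ i = - 1 \<or> y $ i = 1" for i using that by (auto simp: sign_vectors_def)
      thus ?thesis unfolding vec_eq_iff gw_round_def
        by (simp, metis one_neq_neg_one)
    qed
    hence "(\<Sum>y\<in>sign_vectors. g y * indicator {r. \<forall>i. (y $ i = 1) = (0 \<le> column i U \<bullet> r)} r)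
        = (\<Sum>y\<in>sign_vectors. if y = gw_round U r then g y else 0)"
      by (intro sum.cong) (auto simp: indicator_def)
    thus ?thesis
      by (simp add: finite_sign_vectors gw_round_in_sign_vectors)
  qed
  have m: "(\<lambda>r. g (gw_round U r)) \<in> borel_measurable borel"
    unfolding eq by measurable
  have m': "(\<lambda>r. g (gw_round U r)) \<in> borel_measurable uniform_sphere"
    using measurable_restrict_space1[OF m]
    by (subst measurable_cong_sets[OF sets_uniform_sphere refl])
  have "norm (g (gw_round U r)) \<le> Max ((\<lambda>y. norm (g y)) ` sign_vectors)" for r
    by (rule Max_ge) (auto simp: finite_sign_vectors gw_round_in_sign_vectors)
  thus ?thesis
    by (intro integrable_const_bound[OF _ m']) auto
qed

lemma integrable_worst_case_cut_value:
  fixes W' :: "real^'n::{finite,wellorder} \<Rightarrow> real^'n::{finite,wellorder}^'n::{finite,wellorder}"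
  assumes "\<forall>r\<in>sphere 0 1. is_arg_min (\<lambda>W. cut_value W (gw_round U r)) (\<lambda>W. W \<in> \<W>) (W' r)"
  shows "integrable uniform_sphere (\<lambda>r. cut_value (W' r) (gw_round U r))"
proof -
  have "cut_value (W' r) (gw_round U r) = (INF W\<in>\<W>. cut_value W (gw_round U r))"
    if "r \<in> space uniform_sphere" for r
    using assms that by (intro cInf_eq_minimum[symmetric])
      (auto simp: space_uniform_sphere is_arg_min_linorder)
  hence "integrable uniform_sphere (\<lambda>r. cut_value (W' r) (gw_round U r)) \<longleftrightarrow>
      integrable uniform_sphere (\<lambda>r. INF W\<in>\<W>. cut_value W (gw_round U r))"
    by (intro Bochner_Integration.integrable_cong) auto
  thus ?thesis
    using integrable_gw_round[of "\<lambda>y. INF W\<in>\<W>. cut_value W y" U] by simp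
qed

end

theory Submission
  imports Defs
begin

text \<open>
  The rounding cuts the edge \<open>{i, j}\<close> with probability \<open>\<theta> / \<pi>\<close>, where
  \<open>\<theta> = arccos (Y i j)\<close>, and \<open>\<theta> / \<pi> \<ge> 0.878 (1 - cos \<theta>) / 2\<close>.  By linearity, every
  \<open>W\<close> in the uncertainty set has an expected cut of at least 0.878 times its value in the
  relaxation at \<open>Y\<close>, hence at least 0.878 times the optimum of the relaxation, which
  dominates the robust optimum because \<open>y y\<^sup>T\<close> is feasible for every sign vector \<open>y\<close>.  The
  final upper bound holds pointwise in \<open>r\<close>.

  The probability \<open>\<theta> / \<pi>\<close> is found without integration: on a half great circle, the
  probability that a random hyperplane separates two points depends only on their angle by
  rotation invariance, it is additive in that angle, and it equals 1 for antipodal points, so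
  it is linear.
\<close>

section \<open>The Goemans-Williamson constant\<close>

text \<open>Follows from the half-angle formula and
  \<open>\<bar>sin x\<bar> \<le> \<bar>x\<bar>\<close>. It settles small angles and also yields the
  numerical bound on \<open>cos (1/40)\<close>.\<close>

lemma cos_ge_quadratic: "1 - x\<^sup>2 / 2 \<le> cos (x::real)"
proof -
  have "\<bar>sin (x/2)\<bar>\<^sup>2 \<le> \<bar>x/2\<bar>\<^sup>2"
    by (intro power_mono abs_sin_x_le_abs_x) auto
  moreover have "cos x = 1 - 2 * (sin (x/2))\<^sup>2"
    using cos_double_sin[of "x/2"] by simp
  ultimately show ?thesis
    by (simp add: power_divide)
qed

text \<open>Sine decreases on this interval, so cosine is convex there and its graph lies above
  every tangent.\<close>

lemma cos_ge_tangent: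
  fixes x y :: real
  assumes x: "pi/2 \<le> x" "x \<le> pi" and y: "pi/2 \<le> y" "y \<le> pi"
  shows "cos y - sin y * (x - y) \<le> cos x"
proof -
  have sin_antimono: "sin b \<le> sin a" if "pi/2 \<le> a" "a \<le> b" "b \<le> pi" for a b :: real
    using sin_monotone_2pi_le[of "pi - b" "pi - a"] that by simp
  consider "x = y" | "x < y" | "y < x" by linarith
  thus ?thesis
  proof cases
    case 2
    obtain z where z: "x < z" "z < y" "cos y - cos x = (y - x) * - sin z"
      using MVT2[OF 2 DERIV_cos] by blast
    have "(y - x) * sin y \<le> (y - x) * sin z"
      using z x y sin_antimono[of z y] by (intro mult_left_mono) auto
    with z show ?thesis by (simp add: algebra_simps)
  next
    case 3
    obtain z where z: "y < z" "z < x" "cos x - cos y = (x - y) * - sin z"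
      using MVT2[OF 3 DERIV_cos] by blast
    have "(x - y) * sin z \<le> (x - y) * sin y"
      using z x y sin_antimono[of y z] by (intro mult_left_mono) auto
    with z show ?thesis by (simp add: algebra_simps)
  qed simp
qed

text \<open>The least ratio of \<open>t / pi\<close> to \<open>(1 - cos t) / 2\<close> is about
  0.8786, which leaves a little room for rounding. Up to \<open>pi/2\<close> crude bounds on cosine
  suffice; beyond it, convexity replaces cosine by one tangent, and two linear functions remain to
  be compared.\<close>

lemma goemans_williamson_constant:
  fixes t :: real
  assumes t: "0 \<le> t" "t \<le> pi"
  shows "0.878 * ((1 - cos t) / 2) \<le> t / pi"
proof -
  have pi: "3.14159 \<le> pi" "pi \<le> 3.1416"
    using pi_approx by auto
  have "0.439 * pi * (1 - cos t) \<le> t"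
  proof (cases "t \<le> pi/2")
    case True
    hence c: "0 \<le> cos t"
      using t by (intro cos_ge_zero) auto
    show ?thesis
    \<comment> \<open>The quadratic bound works up to 1/0.6896 and the trivial bound
      \<open>1 - cos t \<le> 1\<close> from 1.3792 on; 1.45 lies in the overlap.\<close>
    proof (cases "t \<le> 1.45")
      case True
      have "0.439 * pi * (1 - cos t) \<le> 1.3792 * (t\<^sup>2/2)"
        using pi cos_ge_quadratic[of t] by (intro mult_mono) auto
      also have "\<dots> = (0.6896 * t) * t"
        by (simp add: power2_eq_square)
      also have "\<dots> \<le> 1 * t"
        using t True by (intro mult_right_mono) auto
      finally show ?thesis by simp
    next
      case False
      have "0.439 * pi * (1 - cos t) \<le> 1.3792 * 1"
        using pi c by (intro mult_mono) auto
      with False show ?thesis by simp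
    qed
  next
    case False
    \<comment> \<open>The ratio of the two sides is tightest near t = 2.3311, which is close to z.\<close>
    define z where "z = 3 * pi / 4 - 1/40"
    define \<sigma> :: real where "\<sigma> = sqrt 2 / 2"
    define c s :: real where "c = cos (1/40)" and "s = sin (1/40)"
    have "1.4142 \<le> sqrt 2"
      by (rule real_le_rsqrt) (simp add: power2_eq_square)
    moreover have "sqrt 2 \<le> 1.41422"
      by (rule real_le_lsqrt) (simp_all add: power2_eq_square)
    ultimately have \<sigma>: "0.7071 \<le> \<sigma>" "\<sigma> \<le> 0.70711"
      by (simp_all add: \<sigma>_def)
    \<comment> \<open>The errors 1/3200 and 1/384000 are the Taylor terms x^2/2 and x^3/6 at x =
      1/40.\<close>
    have c: "1 - 1/3200 \<le> c" "c \<le> 1"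
      using cos_ge_quadratic[of "1/40"] by (simp_all add: c_def power2_eq_square)
    have s: "1/40 - 1/384000 \<le> s" "s \<le> 1/40"
      using Maclaurin_sin_bound[of "1/40" 3] sin_x_le_x[of "1/40"]
      by (simp_all add: s_def eval_nat_numeral sin_coeff_def abs_le_iff)
    \<comment> \<open>Since \<open>z\<close> is a small shift of \<open>3 * pi / 4\<close>, the
      addition formulas reduce its sine and cosine to \<sigma>, \<open>c\<close> and
      \<open>s\<close>.\<close>
    have 3: "cos (3 * pi / 4) = - \<sigma>" "sin (3 * pi / 4) = \<sigma>"
      using cos_add[of "pi/2" "pi/4"] sin_add[of "pi/2" "pi/4"]
      by (simp_all add: cos_45 sin_45 \<sigma>_def)
    have cz: "cos z = \<sigma> * s - \<sigma> * c" and sz: "sin z = \<sigma> * c + \<sigma> * s"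
      unfolding z_def cos_diff sin_diff 3 c_def s_def by simp_all
    have \<sigma>c: "0.7068 \<le> \<sigma> * c" "\<sigma> * c \<le> 0.70711"
      using mult_mono[of "0.7071" \<sigma> "1 - 1/3200" c] mult_mono[of \<sigma> "0.70711" c 1] \<sigma> c by auto
    have \<sigma>s: "0.01767 \<le> \<sigma> * s" "\<sigma> * s \<le> 0.01768"
      using mult_mono[of "0.7071" \<sigma> "1/40 - 1/384000" s] mult_mono[of \<sigma> "0.70711" s "1/40"] \<sigma> s by auto
    have d: "0.76039 \<le> z - pi/2" "z - pi/2 \<le> 0.7604"
      using pi by (simp_all add: z_def)
    \<comment> \<open>The tangent at \<open>z\<close> is rewritten around \<open>pi/2\<close>. After
      scaling by \<open>0.439 * pi\<close> it stays below the line \<open>t\<close> as soon as its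
      value at \<open>pi/2\<close> is at most \<open>pi/2\<close> and its slope is at most
      1.\<close>
    have tangent: "1 - cos t \<le> (1 - cos z - sin z * (z - pi/2)) + sin z * (t - pi/2)"
      using cos_ge_tangent[of t z] False t pi d by (simp add: z_def algebra_simps)
    have "\<sigma> * c * (1 - (z - pi/2)) \<le> 0.70711 * 0.23961"
      using \<sigma>c d by (intro mult_mono) auto
    moreover have "0.01767 * 1.76039 \<le> \<sigma> * s * (1 + (z - pi/2))"
      using \<sigma>s d by (intro mult_mono) auto
    moreover have "1 - cos z - sin z * (z - pi/2)
        = 1 + \<sigma> * c * (1 - (z - pi/2)) - \<sigma> * s * (1 + (z - pi/2))"
      by (simp add: cz sz algebra_simps)
    ultimately have "1 - cos z - sin z * (z - pi/2) \<le> 1.1386"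
      by simp
    hence "0.439 * pi * (1 - cos z - sin z * (z - pi/2)) \<le> 0.439 * pi * 1.1386"
      using pi by (intro mult_left_mono) auto
    also have "\<dots> \<le> pi/2"
      using pi by simp
    finally have at_half_pi: "0.439 * pi * (1 - cos z - sin z * (z - pi/2)) \<le> pi/2" .
    have "0.439 * pi * sin z \<le> 1.37917 * 0.7248"
      using pi_approx \<sigma>c \<sigma>s unfolding sz by (intro mult_mono) auto
    hence slope: "0.439 * pi * sin z * (t - pi/2) \<le> 1 * (t - pi/2)"
      using False by (intro mult_right_mono) auto
    have "0.439 * pi * (1 - cos t)
        \<le> 0.439 * pi * ((1 - cos z - sin z * (z - pi/2)) + sin z * (t - pi/2))"
      using tangent pi by (intro mult_left_mono) auto
    also have "\<dots> = 0.439 * pi * (1 - cos z - sin z * (z - pi/2)) + 0.439 * pi * sin z * (t - pi/2)"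
      by (simp only: distrib_left mult.assoc)
    also have "\<dots> \<le> pi/2 + 1 * (t - pi/2)"
      by (rule add_mono[OF at_half_pi slope])
    also have "\<dots> = t"
      by simp
    finally show ?thesis .
  qed
  thus ?thesis
    by (simp add: field_simps)
qed

section \<open>Probability of separation by a random hyperplane\<close>

text \<open>Only the lower bound has to be proved: the lower bounds at \<open>t\<close> and
  \<open>a - t\<close> add up to exactly \<open>p a\<close>, as do the values themselves, so both
  are equalities. The lower bound comes from approximating \<open>t\<close> by multiples of
  \<open>a / m\<close>, on which additivity alone gives linearity.\<close>

lemma additive_nonneg_imp_linear:
  fixes p :: "real \<Rightarrow> real"
  assumes a: "0 < a"
    and add: "\<And>s t. 0 \<le> s \<Longrightarrow> 0 \<le> t \<Longrightarrow> s + t \<le> a \<Longrightarrow> p (s + t) = p s + p t"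
    and nonneg: "\<And>t. 0 \<le> t \<Longrightarrow> t \<le> a \<Longrightarrow> 0 \<le> p t"
    and t: "0 \<le> t" "t \<le> a"
  shows "p t = t / a * p a"
proof -
  have lower: "t / a * p a \<le> p t" if t: "0 \<le> t" "t \<le> a" for t
  proof (rule field_le_epsilon)
    fix e :: real assume e: "0 < e"
    \<comment> \<open>The mesh \<open>a / m\<close> is so fine that one grid step contributes
      \<open>p a / m\<close>, which is less than \<open>e\<close>.\<close>
    obtain m :: nat where m: "p a / e < real m"
      using reals_Archimedean2 by blast
    have "0 \<le> p a" using nonneg a by simp
    hence "0 \<le> p a / e" using e by simp
    with m have m0: "0 < real m" by linarith
    have mult: "p (real k * (a / real m)) = real k * p (a / real m)" if "k \<le> m" for k
      using that
    proof (induction k)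
      case 0
      show ?case using add[of 0 0] a by simp
    next
      case (Suc k)
      have "real (Suc k) * (a / real m) \<le> real m * (a / real m)"
        using Suc.prems a by (intro mult_right_mono) auto
      hence "real k * (a / real m) + a / real m \<le> a"
        using m0 by (simp add: add_divide_distrib algebra_simps)
      thus ?case
        using add[of "real k * (a / real m)" "a / real m"] Suc a
        by (simp add: add_divide_distrib algebra_simps)
    qed
    have pa: "p (a / real m) = p a / real m"
      using mult[of m] m0 by (simp add: field_simps)
    \<comment> \<open>The last grid point not beyond \<open>t\<close>. Nonnegativity of
      \<open>p\<close> on the remaining gap makes its value at most \<open>p t\<close>, and the gap
      is at most one grid step.\<close>
    define k where "k = nat \<lfloor>t * real m / a\<rfloor>"
    have k: "real k \<le> t * real m / a" "t * real m / a - 1 \<le> real k"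
      unfolding k_def using t a m0 by (auto simp: of_nat_nat)
    have kt: "0 \<le> real k * (a / real m)" "real k * (a / real m) \<le> t"
      using k(1) a m0 by (simp_all add: field_simps)
    hence "0 \<le> p (t - real k * (a / real m))"
      using t by (intro nonneg) linarith+
    have "t * real m / a \<le> real m"
      using t a m0 by (simp add: field_simps)
    with k have "k \<le> m" by linarith
    have "t / a * p a \<le> (real k / real m + 1 / real m) * p a"
      using k(2) a m0 \<open>0 \<le> p a\<close> by (intro mult_right_mono) (auto simp: field_simps)
    also have "\<dots> = p (real k * (a / real m)) + p a / real m"
      unfolding mult[OF \<open>k \<le> m\<close>] pa by (simp add: distrib_right)
    also have "p (real k * (a / real m)) \<le> p t"
      using add[of "real k * (a / real m)" "t - real k * (a / real m)"]
        \<open>0 \<le> p (t - real k * (a / real m))\<close> kt t by simp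
    also have "p a / real m \<le> e"
      using m e m0 by (simp add: field_simps)
    finally show "t / a * p a \<le> p t + e" by simp
  qed
  have "p a = p t + p (a - t)"
    using add[of t "a - t"] t by simp
  moreover have "t / a * p a + (a - t) / a * p a = p a"
    using a by (simp add: field_simps)
  ultimately show ?thesis
    using lower[of t] lower[of "a - t"] t by simp
qed

section \<open>Directions that separate two vectors\<close>

definition separators :: "'a::euclidean_space \<Rightarrow> 'a \<Rightarrow> 'a set" where
  "separators u v = {r \<in> sphere 0 1. (0 \<le> u \<bullet> r) \<noteq> (0 \<le> v \<bullet> r)}"

lemma separators_borel [measurable]: "separators u v \<in> sets borel"
proof -
  have "{r. 0 \<le> w \<bullet> r} \<in> sets borel" for w :: 'a
    by measurable
  moreover have "separators u v = sphere 0 1 \<inter>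
      (({r. 0 \<le> u \<bullet> r} - {r. 0 \<le> v \<bullet> r}) \<union> ({r. 0 \<le> v \<bullet> r} - {r. 0 \<le> u \<bullet> r}))"
    by (auto simp: separators_def)
  ultimately show ?thesis
    by (simp add: borel_closed)
qed

lemma separators_subset_sphere: "separators u v \<subseteq> sphere 0 1"
  by (auto simp: separators_def)

lemma sets_uniform_sphere_iff:
  "A \<in> sets (uniform_sphere :: 'a::euclidean_space measure) \<longleftrightarrow> A \<in> sets borel \<and> A \<subseteq> sphere 0 1"
  unfolding sets_uniform_sphere by (subst sets_restrict_space_iff) (auto simp: borel_closed)

lemma separators_in_sets_uniform_sphere: "separators u v \<in> sets uniform_sphere"
  by (simp add: sets_uniform_sphere_iff separators_subset_sphere separators_borel)

text \<open>The cone over the exceptional directions lies in a hyperplane through the origin, which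
  is Lebesgue null. This discards ties in the sign rule.\<close>

lemma AE_uniform_sphere_not_orthogonal:
  fixes v :: "'a::euclidean_space"
  assumes "v \<noteq> 0"
  shows "AE r in uniform_sphere. v \<bullet> r \<noteq> 0"
proof (rule AE_I')
  let ?N = "{r \<in> sphere 0 1. v \<bullet> r = 0}"
  have "closed {r. v \<bullet> r = 0}"
    by (rule closed_hyperplane)
  moreover have "?N = sphere 0 1 \<inter> {r. v \<bullet> r = 0}" by auto
  ultimately have N: "?N \<in> sets borel"
    by (simp add: borel_closed closed_Int)
  have sub: "ball 0 1 \<inter> sgn -` ?N \<subseteq> {x. v \<bullet> x = 0}"
    by (auto simp: sgn_div_norm)
  have null: "{x. v \<bullet> x = 0} \<in> null_sets lborel"
    using negligible_hyperplane[of v 0] assms \<open>closed {r. v \<bullet> r = 0}\<close>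
    by (simp add: negligible_iff_null_sets null_sets_completion_iff borel_closed)
  have "emeasure lborel (ball 0 1 \<inter> sgn -` ?N) = 0"
    by (rule emeasure_eq_0[OF null_setsD2[OF null] null_setsD1[OF null] sub])
  hence "emeasure uniform_sphere ?N = 0"
    by (subst emeasure_uniform_sphere[OF N]) auto
  thus "?N \<in> null_sets uniform_sphere"
    using N by (auto simp: null_sets_def sets_uniform_sphere_iff)
qed (auto simp: space_uniform_sphere)

text \<open>An orthogonal map preserves norms and inner products, so it carries the separating
  directions of a pair onto those of its image; rotation invariance of the measure does the
  rest.\<close>

lemma measure_separators_orthogonal:
  fixes f :: "real^'n::{finite,wellorder} \<Rightarrow> real^'n::{finite,wellorder}"
  assumes f: "orthogonal_transformation f"
  shows "measure uniform_sphere (separators (f u) (f v)) = measure uniform_sphere (separators u v)"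
proof -
  have "f ` separators u v = separators (f u) (f v)"
  proof (intro equalityI subsetI)
    fix y assume y: "y \<in> separators (f u) (f v)"
    obtain x where "y = f x"
      using orthogonal_transformation_surj[OF f] by (metis surjD)
    with y f show "y \<in> f ` separators u v"
      by (auto simp: separators_def orthogonal_transformation_norm orthogonal_transformation_def)
  qed (use f in \<open>auto simp: separators_def orthogonal_transformation_norm orthogonal_transformation_def\<close>)
  thus ?thesis
    using uniform_sphere_orthogonal_invariant[OF f separators_borel separators_subset_sphere, of u v]
    by (simp add: measure_def)
qed

section \<open>Rotations and arcs of a great circle\<close>

definition great_circle :: "'a::euclidean_space \<Rightarrow> 'a \<Rightarrow> real \<Rightarrow> 'a" where
  "great_circle e f t = cos t *\<^sub>R e + sin t *\<^sub>R f"

lemma great_circle_0 [simp]: "great_circle e f 0 = e"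
  by (simp add: great_circle_def)

lemma great_circle_pi [simp]: "great_circle e f pi = - e"
  by (simp add: great_circle_def)

text \<open>The map rotates the plane of \<open>e\<close> and \<open>f\<close> by \<open>c\<close>
  and fixes its orthogonal complement. It adds to \<open>x\<close> the change in its planar
  component, which avoids extending \<open>e\<close>, \<open>f\<close> to a basis.\<close>

lemma great_circle_rotation:
  fixes e f :: "'a::euclidean_space"
  assumes e: "norm e = 1" and f: "norm f = 1" and ef: "e \<bullet> f = 0"
  obtains T where "orthogonal_transformation T"
    "\<And>t. T (great_circle e f t) = great_circle e f (c + t)"
proof
  define T where "T x = x + ((cos c - 1) * (x \<bullet> e) - sin c * (x \<bullet> f)) *\<^sub>R e
      + (sin c * (x \<bullet> e) + (cos c - 1) * (x \<bullet> f)) *\<^sub>R f" for x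
  have ee: "e \<bullet> e = 1" "f \<bullet> f = 1" "f \<bullet> e = 0"
    using e f ef by (simp_all add: norm_eq_1 inner_commute)
  have "linear T"
    by (rule linearI) (simp_all add: T_def inner_simps algebra_simps)
  moreover have "T x \<bullet> T y = x \<bullet> y" for x y
  proof -
    \<comment> \<open>The left side is what the inner product gains under the map; it vanishes
      because \<open>C\<close> and \<open>S\<close> become a cosine and a sine of the same
      angle.\<close>
    have quadratic: "((C - 1) * p - S * q) * p' + (S * p + (C - 1) * q) * q'
        + ((C - 1) * p' - S * q') * p + (S * p' + (C - 1) * q') * q
        + ((C - 1) * p - S * q) * ((C - 1) * p' - S * q')
        + (S * p + (C - 1) * q) * (S * p' + (C - 1) * q') = (S\<^sup>2 + C\<^sup>2 - 1) * (p * p' + q * q')"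
      for C S p q p' q' :: real
      by (simp add: power2_eq_square algebra_simps)
    have expand: "(x + a *\<^sub>R e + b *\<^sub>R f) \<bullet> (y + a' *\<^sub>R e + b' *\<^sub>R f)
        = x \<bullet> y + (a * (y \<bullet> e) + b * (y \<bullet> f) + a' * (x \<bullet> e) + b' * (x \<bullet> f) + a * a' + b * b')"
      for a b a' b'
      by (simp add: inner_simps ee ef inner_commute[of e y] inner_commute[of f y] algebra_simps)
    show ?thesis
      unfolding T_def expand quadratic by simp
  qed
  ultimately show "orthogonal_transformation T"
    by (simp add: orthogonal_transformation_def)
  show "T (great_circle e f t) = great_circle e f (c + t)" for t
    by (simp add: T_def great_circle_def inner_simps ee ef cos_add sin_add algebra_simps)
qed

text \<open>Rotation by \<open>s\<close> moves the arc from 0 to \<open>t\<close> onto the arc from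
  \<open>s\<close> to \<open>s + t\<close>.\<close>

lemma measure_separators_great_circle_shift:
  fixes e f :: "real^'n::{finite,wellorder}"
  assumes "norm e = 1" "norm f = 1" "e \<bullet> f = 0"
  shows "measure uniform_sphere (separators (great_circle e f s) (great_circle e f (s + t)))
    = measure uniform_sphere (separators e (great_circle e f t))"
proof -
  obtain T where T: "orthogonal_transformation T"
      "\<And>t. T (great_circle e f t) = great_circle e f (s + t)"
    using great_circle_rotation[OF assms] by metis
  show ?thesis
    using measure_separators_orthogonal[OF T(1), of e "great_circle e f t"] T(2)[of 0] T(2)[of t]
    by simp
qed

text \<open>
  Along a half circle the inner product with a fixed vector changes sign at most once, so a
  hyperplane separating the two ends of an arc separates exactly one of its two sub-arcs.
\<close>

lemma separators_great_circle_split: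
  fixes e f r :: "'a::euclidean_space"
  assumes s: "0 \<le> s" and t: "0 \<le> t" and st: "s + t \<le> pi" and r: "e \<bullet> r \<noteq> 0"
  defines "w \<equiv> great_circle e f"
  assumes same: "(0 \<le> e \<bullet> r) = (0 \<le> w (s + t) \<bullet> r)"
  shows "(0 \<le> w s \<bullet> r) = (0 \<le> e \<bullet> r)"
proof -
  consider "s = 0" | "s + t = pi" | "0 < s" "s + t < pi"
    using s st by linarith
  thus ?thesis
  proof cases
    case 1
    thus ?thesis by (simp add: w_def)
  next
    case 2
    \<comment> \<open>The ends are antipodal here, so \<open>same\<close> contradicts
      \<open>r\<close>.\<close>
    with same r show ?thesis by (cases "0 \<le> e \<bullet> r") (auto simp: w_def)
  next
    case 3
    have sn: "0 < sin s" "0 \<le> sin t" "0 < sin (s + t)"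
      using 3 s t by (auto intro: sin_gt_zero sin_ge_zero)
    \<comment> \<open>Up to the positive factor \<open>sin (s + t)\<close>, the middle point is a
      combination of the two ends with coefficients \<open>sin t \<ge> 0\<close> and
      \<open>sin s > 0\<close>, so it lies on their common side.\<close>
    have "sin (s + t) * cos s = sin t + cos (s + t) * sin s"
      using sin_diff[of "s + t" s] by simp
    hence "(sin (s + t) * cos s) * (e \<bullet> r) = (sin t + cos (s + t) * sin s) * (e \<bullet> r)"
      by simp
    hence eq: "sin (s + t) * (w s \<bullet> r) = sin t * (e \<bullet> r) + sin s * (w (s + t) \<bullet> r)"
      by (simp add: w_def great_circle_def inner_simps algebra_simps)
    show ?thesis
    proof (cases "0 \<le> e \<bullet> r")
      case True
      with same sn have "0 \<le> sin (s + t) * (w s \<bullet> r)"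
        unfolding eq by simp
      with sn True show ?thesis by (simp add: zero_le_mult_iff)
    next
      case False
      with same sn have "sin (s + t) * (w s \<bullet> r) < 0"
        unfolding eq by (intro add_nonpos_neg) (auto simp: mult_le_0_iff mult_less_0_iff)
      with sn False show ?thesis by (simp add: mult_less_0_iff)
    qed
  qed
qed

text \<open>Almost surely, separating the ends of an arc means separating exactly one of its two
  sub-arcs; the second sub-arc is then shifted back to start at \<open>e\<close>.\<close>

lemma measure_separators_great_circle_add:
  fixes e f :: "real^'n::{finite,wellorder}"
  assumes ef: "norm e = 1" "norm f = 1" "e \<bullet> f = 0"
    and st: "0 \<le> s" "0 \<le> t" "s + t \<le> pi"
  defines "p \<equiv> \<lambda>t. measure uniform_sphere (separators e (great_circle e f t))"
  shows "p (s + t) = p s + p t"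
proof -
  interpret prob_space "uniform_sphere :: (real^'n::{finite,wellorder}) measure"
    by (rule prob_space_uniform_sphere)
  let ?w = "great_circle e f"
  let ?A = "separators e (?w s)" and ?B = "separators (?w s) (?w (s + t))"
    and ?C = "separators e (?w (s + t))"
  have "e \<noteq> 0" using ef by auto
  \<comment> \<open>Two sign changes would put the ends on the same side, and then the middle point
    would lie on that side too.\<close>
  have disj: "AE r in uniform_sphere. r \<notin> ?A \<or> r \<notin> ?B"
    using AE_uniform_sphere_not_orthogonal[OF \<open>e \<noteq> 0\<close>]
    by eventually_elim (use separators_great_circle_split[OF st, of e _ f] in \<open>auto simp: separators_def\<close>)
  have "AE r in uniform_sphere. r \<in> ?C \<longleftrightarrow> r \<in> ?A \<union> ?B"
    using disj by eventually_elim (auto simp: separators_def)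
  hence "p (s + t) = measure uniform_sphere (?A \<union> ?B)"
    unfolding p_def by (intro measure_eq_AE) (auto simp: separators_in_sets_uniform_sphere)
  also have "\<dots> = measure uniform_sphere ?A + measure uniform_sphere ?B"
    using disj by (intro measure_Un_AE) (auto simp: separators_in_sets_uniform_sphere fmeasurable_eq_sets)
  finally show ?thesis
    using measure_separators_great_circle_shift[OF ef] by (simp add: p_def)
qed

section \<open>The separation probability of two unit vectors\<close>

lemma measure_separators_antipodal:
  fixes u :: "'a::euclidean_space"
  assumes "u \<noteq> 0"
  shows "measure uniform_sphere (separators u (- u)) = 1"
proof -
  interpret prob_space "uniform_sphere :: 'a measure"
    by (rule prob_space_uniform_sphere)
  \<comment> \<open>Only directions orthogonal to \<open>u\<close> fail: there both inner products
    are 0 and count as nonnegative.\<close>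
  have "AE r in uniform_sphere. r \<in> separators u (- u)"
    using AE_uniform_sphere_not_orthogonal[OF assms] AE_space
    by eventually_elim (auto simp: separators_def space_uniform_sphere)
  thus ?thesis
    by (simp add: prob_eq_1 separators_in_sets_uniform_sphere)
qed

text \<open>If \<open>u\<close> and \<open>v\<close> are not parallel, \<open>v\<close> lies at
  angle \<open>arccos (u \<bullet> v)\<close> on a half circle from \<open>u\<close> to
  \<open>- u\<close>, where the probability is additive in the angle and ends at 1. Parallel vectors
  determine no such half circle and are treated directly.\<close>

theorem measure_separators:
  fixes u v :: "real^'n::{finite,wellorder}"
  assumes u: "norm u = 1" and v: "norm v = 1"
  shows "measure uniform_sphere (separators u v) = arccos (u \<bullet> v) / pi"
proof -
  define c where "c = u \<bullet> v"
  have uv: "u \<bullet> u = 1" "v \<bullet> v = 1" "v \<bullet> u = c"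
    using u v by (simp_all add: norm_eq_1 c_def inner_commute)
  have "\<bar>c\<bar> \<le> 1"
    using Cauchy_Schwarz_ineq2[of u v] u v by (simp add: c_def)
  then consider "c = 1" | "c = -1" | "-1 < c" "c < 1"
    by linarith
  thus ?thesis
  proof cases
    case 1
    hence "(u - v) \<bullet> (u - v) = 0"
      using uv by (simp add: inner_simps c_def[symmetric])
    hence "v = u" by simp
    with uv show ?thesis by (simp add: separators_def)
  next
    case 2
    hence "(u + v) \<bullet> (u + v) = 0"
      using uv by (simp add: inner_simps c_def[symmetric])
    hence "v = - u" by (simp add: eq_neg_iff_add_eq_0 add.commute)
    moreover have "u \<noteq> 0" using u by auto
    ultimately show ?thesis
      using uv 2 by (simp add: measure_separators_antipodal)
  next
    case 3
    \<comment> \<open>Gram-Schmidt: \<open>d\<close> is the length of the component of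
      \<open>v\<close> orthogonal to \<open>u\<close>, and \<open>f\<close> is its
      direction.\<close>
    define d where "d = sqrt (1 - c\<^sup>2)"
    have "c\<^sup>2 < 1"
      using 3 by (simp add: abs_square_less_1)
    hence d: "0 < d" "d * d = 1 - c * c"
      by (simp_all add: d_def power2_eq_square[symmetric])
    define f where "f = (1/d) *\<^sub>R (v - c *\<^sub>R u)"
    have uf: "u \<bullet> f = 0"
      using uv by (simp add: f_def inner_simps c_def)
    have "(v - c *\<^sub>R u) \<bullet> (v - c *\<^sub>R u) = d * d"
      unfolding d using uv by (simp add: inner_simps c_def[symmetric])
    hence "f \<bullet> f = 1"
      using d \<open>c\<^sup>2 < 1\<close> by (auto simp: f_def power2_eq_square)
    hence f: "norm f = 1"
      by (simp add: norm_eq_1)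
    have gc: "great_circle u f (arccos c) = v"
      using 3 d by (simp add: great_circle_def f_def sin_arccos_abs d_def[symmetric])
    have "0 \<le> arccos c" "arccos c \<le> pi"
      using 3 by (auto intro: arccos_lbound arccos_ubound)
    hence "measure uniform_sphere (separators u (great_circle u f (arccos c)))
        = arccos c / pi * measure uniform_sphere (separators u (great_circle u f pi))"
      by (intro additive_nonneg_imp_linear[where
            p = "\<lambda>t. measure uniform_sphere (separators u (great_circle u f t))"]
          measure_separators_great_circle_add[OF u f uf]) auto
    moreover have "u \<noteq> 0" using u by auto
    ultimately show ?thesis
      by (simp add: gc measure_separators_antipodal flip: c_def)
  qed
qed

section \<open>The robust problem and its relaxation\<close>

text \<open>On the sphere, \<open>(1 - y $ i * y $ j) / 2\<close> for the rounded \<open>y\<close>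
  is the indicator of the separating directions, since both sign rules count 0 as nonnegative;
  linearity of the integral finishes.\<close>

lemma expected_cut_value:
  fixes W U :: "real^'n::{finite,wellorder}^'n::{finite,wellorder}"
  shows "(\<integral>r. cut_value W (gw_round U r) \<partial>uniform_sphere)
    = (\<Sum>(i, j)\<in>{(i, j). i < j}. W $ i $ j * measure uniform_sphere (separators (column i U) (column j U)))"
proof -
  interpret prob_space "uniform_sphere :: (real^'n::{finite,wellorder}) measure"
    by (rule prob_space_uniform_sphere)
  have "(\<integral>r. cut_value W (gw_round U r) \<partial>uniform_sphere)
     = (\<integral>r. (\<Sum>(i, j)\<in>{(i, j). i < j}. W $ i $ j * indicator (separators (column i U) (column j U)) r)
         \<partial>uniform_sphere)"
    by (intro Bochner_Integration.integral_cong refl)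
      (auto simp: cut_value_def gw_round_def separators_def space_uniform_sphere intro!: sum.cong)
  also have "\<dots> = (\<Sum>(i, j)\<in>{(i, j). i < j}. W $ i $ j *
      measure uniform_sphere (separators (column i U) (column j U)))"
    by (subst Bochner_Integration.integral_sum)
      (auto simp: split_beta separators_in_sets_uniform_sphere intro!: sum.cong
        integrable_real_indicator simp flip: top.not_eq_extremum)
  finally show ?thesis .
qed

text \<open>The diagonal terms vanish and symmetry counts every edge twice. This reconciles the
  factor 1/4 of the relaxation with the factor 1/2 of the cut.\<close>

lemma inner_ones_minus:
  fixes W Y :: "real^'n::{finite,wellorder}^'n::{finite,wellorder}"
  assumes W: "transpose W = W" and Y: "transpose Y = Y" "\<And>i. Y $ i $ i = 1"
  shows "W \<bullet> (ones_mat - Y) = 2 * (\<Sum>(i, j)\<in>{(i, j). i < j}. W $ i $ j * (1 - Y $ i $ j))"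
proof -
  let ?g = "\<lambda>(i, j). W $ i $ j * (1 - Y $ i $ j)"
  let ?L = "{(i, j). i < (j::'n::{finite,wellorder})}" and ?G = "{(i, j). j < (i::'n::{finite,wellorder})}" and ?D = "{(i, j). i = (j::'n::{finite,wellorder})}"
  have Wc: "W $ i $ j = W $ j $ i" and Yc: "Y $ i $ j = Y $ j $ i" for i j
    using arg_cong[OF W, of "\<lambda>M. M $ j $ i"] arg_cong[OF Y(1), of "\<lambda>M. M $ j $ i"]
    by (simp_all add: transpose_def)
  have "W \<bullet> (ones_mat - Y) = (\<Sum>i\<in>UNIV. \<Sum>j\<in>UNIV. W $ i $ j * (1 - Y $ i $ j))"
    by (simp add: inner_vec_def ones_mat_def)
  also have "\<dots> = sum ?g UNIV"
    by (simp only: sum.cartesian_product UNIV_Times_UNIV)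
  also have "(UNIV :: ('n::{finite,wellorder} \<times> 'n::{finite,wellorder}) set) = (?L \<union> ?G) \<union> ?D"
    by auto
  also have "sum ?g \<dots> = sum ?g ?L + sum ?g ?G + sum ?g ?D"
    by (subst sum.union_disjoint; (subst sum.union_disjoint)?) auto
  also have "sum ?g ?D = 0"
    by (rule sum.neutral) (auto simp: Y)
  also have "sum ?g ?G = sum ?g ?L"
    by (rule sum.reindex_bij_witness[of _ prod.swap prod.swap]) (auto simp: Wc Yc)
  finally show ?thesis by simp
qed

text \<open>\<open>Y\<close> is the Gram matrix of the columns of \<open>U\<close>, which are unit
  vectors by the unit diagonal. The angle inequality at \<open>arccos (Y $ i $ j)\<close> therefore
  bounds each edge, and nonnegative weights allow summation.\<close>

lemma expected_cut_value_ge: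
  fixes W Y U :: "real^'n::{finite,wellorder}^'n::{finite,wellorder}"
  assumes W: "transpose W = W" "\<And>i j. 0 \<le> W $ i $ j"
    and Y: "Y \<in> sdp_feasible" and U: "Y = transpose U ** U"
  shows "0.878 * (1/4 * (W \<bullet> (ones_mat - Y))) \<le> (\<integral>r. cut_value W (gw_round U r) \<partial>uniform_sphere)"
proof -
  have Yij: "Y $ i $ j = column i U \<bullet> column j U" for i j
    by (simp add: U matrix_mult_transpose_dot_column)
  have Y': "transpose Y = Y" "Y $ i $ i = 1" for i
    using Y by (auto simp: sdp_feasible_def psd_def)
  hence norm: "norm (column i U) = 1" for i
    by (simp add: norm_eq_1 Yij[symmetric])
  have "0.878 * ((1 - Y $ i $ j) / 2)
      \<le> measure uniform_sphere (separators (column i U) (column j U))" for i j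
  proof -
    have "\<bar>Y $ i $ j\<bar> \<le> 1"
      using Cauchy_Schwarz_ineq2[of "column i U" "column j U"] norm by (simp add: Yij)
    hence "-1 \<le> Y $ i $ j" "Y $ i $ j \<le> 1" by auto
    hence "0.878 * ((1 - Y $ i $ j) / 2) \<le> arccos (Y $ i $ j) / pi"
      using goemans_williamson_constant[of "arccos (Y $ i $ j)"]
      by (auto simp: arccos_lbound arccos_ubound)
    thus ?thesis
      by (simp add: measure_separators norm Yij)
  qed
  hence le: "W $ i $ j * (0.878 * ((1 - Y $ i $ j) / 2))
      \<le> W $ i $ j * measure uniform_sphere (separators (column i U) (column j U))" for i j
    by (intro mult_left_mono W)
  have "(\<Sum>(i, j)\<in>{(i, j). i < j}. W $ i $ j * (0.878 * ((1 - Y $ i $ j) / 2)))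
      \<le> (\<integral>r. cut_value W (gw_round U r) \<partial>uniform_sphere)"
    unfolding expected_cut_value by (intro sum_mono) (clarify, rule le)
  moreover have "0.878 * (1/4 * (W \<bullet> (ones_mat - Y)))
      = (\<Sum>(i, j)\<in>{(i, j). i < j}. W $ i $ j * (0.878 * ((1 - Y $ i $ j) / 2)))"
    unfolding inner_ones_minus[OF W(1) Y'] by (simp add: sum_distrib_left split_beta right_diff_distrib diff_divide_distrib mult_ac)
  ultimately show ?thesis by simp
qed

section \<open>Cuts as feasible points of the relaxation\<close>

definition rank_one :: "real^'n \<Rightarrow> real^'n^'n" where
  "rank_one y = (\<chi> i j. y $ i * y $ j)"

text \<open>The quadratic form of this matrix is the square of \<open>x \<bullet> y\<close>, and the
  diagonal consists of squares of signs.\<close>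

lemma rank_one_sdp_feasible:
  assumes "y \<in> sign_vectors"
  shows "rank_one y \<in> sdp_feasible"
proof -
  have "x \<bullet> (rank_one y *v x) = (x \<bullet> y)\<^sup>2" for x
    by (simp add: rank_one_def inner_vec_def matrix_vector_mult_def power2_eq_square sum_product
        sum_distrib_left mult_ac)
  moreover have "y $ i * y $ i = 1" for i
    using assms by (auto simp: sign_vectors_def dest!: spec[of _ i])
  ultimately show ?thesis
    by (simp add: sdp_feasible_def psd_def rank_one_def transpose_def mult.commute)
qed

lemma sign_vectors_nonempty: "sign_vectors \<noteq> {}"
  using gw_round_in_sign_vectors by blast

text \<open>Evaluating every infimum at a minimizer avoids separate arguments about nonemptiness and
  boundedness below.\<close>

lemma cINF_eq_arg_min:
  fixes g :: "'a \<Rightarrow> real"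
  assumes "is_arg_min g (\<lambda>x. x \<in> A) x"
  shows "(INF x\<in>A. g x) = g x"
  using assms by (intro cInf_eq_minimum) (auto simp: is_arg_min_linorder)

theorem theorem1:
  fixes \<W> :: "(real^'n::{finite,wellorder}^'n::{finite,wellorder}) set"
    and Yhat What U :: "real^'n::{finite,wellorder}^'n::{finite,wellorder}"
  assumes sym: "\<And>W. W \<in> \<W> \<Longrightarrow> transpose W = W"
    and nonneg: "\<And>W i j. W \<in> \<W> \<Longrightarrow> 0 \<le> W $ i $ j"
    and attained_RP: "\<And>y. y \<in> sign_vectors \<Longrightarrow>
      \<exists>W. is_arg_min (\<lambda>W. \<Sum>(i, j)\<in>{(i, j). i < j}. W $ i $ j * (1 - y $ i * y $ j)) (\<lambda>W. W \<in> \<W>) W"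
    and attained_SDP: "\<And>Y. Y \<in> sdp_feasible \<Longrightarrow>
      \<exists>W. is_arg_min (\<lambda>W. 1/4 * (W \<bullet> (ones_mat - Y))) (\<lambda>W. W \<in> \<W>) W"
    and Yhat: "is_arg_max (sdp_objective \<W>) (\<lambda>Y. Y \<in> sdp_feasible) Yhat"
    and What: "is_arg_min (\<lambda>W. W \<bullet> (ones_mat - Yhat)) (\<lambda>W. W \<in> \<W>) What"
    and U: "Yhat = transpose U ** U"
  shows "(\<forall>W\<in>\<W>. (\<integral>r. cut_value W (gw_round U r) \<partial>uniform_sphere) \<ge> 0.878 * val_RP \<W>) \<and>
    (\<integral>r. cut_value What (gw_round U r) \<partial>uniform_sphere) \<ge> 0.878 * val_RP \<W> \<and>
    (\<forall>What' :: real^'n::{finite,wellorder} \<Rightarrow> real^'n::{finite,wellorder}^'n::{finite,wellorder}.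
      (\<forall>r\<in>sphere 0 1. is_arg_min (\<lambda>W. cut_value W (gw_round U r)) (\<lambda>W. W \<in> \<W>) (What' r)) \<longrightarrow>
      val_RP \<W> \<ge> (\<integral>r. cut_value (What' r) (gw_round U r) \<partial>uniform_sphere))"
proof -
  let ?g = "\<lambda>y W. \<Sum>(i, j)\<in>{(i, j). i < j}. W $ i $ j * (1 - y $ i * y $ j)"
  let ?m = "\<lambda>y. INF W\<in>\<W>. ?g y W"
  have cut: "cut_value W y = 1/2 * ?g y W" for W y
    by (simp add: cut_value_def sum_distrib_left split_beta)
  have Y: "Yhat \<in> sdp_feasible"
    using Yhat by (simp add: is_arg_max_linorder)
  have relaxation: "val_RP \<W> \<le> sdp_objective \<W> Yhat"
  proof -
    have "Max (?m ` sign_vectors) \<in> ?m ` sign_vectors"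
      by (rule Max_in) (auto simp: finite_sign_vectors sign_vectors_nonempty)
    then obtain y where y: "y \<in> sign_vectors" "Max (?m ` sign_vectors) = ?m y"
      by auto
    have feas: "rank_one y \<in> sdp_feasible"
      using y by (intro rank_one_sdp_feasible)
    hence R: "transpose (rank_one y) = rank_one y" "rank_one y $ i $ i = 1" for i
      by (auto simp: sdp_feasible_def psd_def)
    \<comment> \<open>The robust and the relaxed inner problem at \<open>y\<close> have proportional
      objectives. Their minimizers are obtained separately, and optimality of \<open>V'\<close>
      against \<open>V\<close> gives the inequality.\<close>
    obtain V where V: "is_arg_min (\<lambda>W. 1/4 * (W \<bullet> (ones_mat - rank_one y))) (\<lambda>W. W \<in> \<W>) V"
      using attained_SDP[OF feas] by blast
    obtain V' where V': "is_arg_min (?g y) (\<lambda>W. W \<in> \<W>) V'"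
      using attained_RP[OF y(1)] by blast
    have VW: "V \<in> \<W>"
      using V by (simp add: is_arg_min_linorder)
    have "val_RP \<W> = 1/2 * ?g y V'"
      unfolding val_RP_def y(2) cINF_eq_arg_min[OF V'] ..
    also have "\<dots> \<le> 1/2 * ?g y V"
      using V' VW by (simp add: is_arg_min_linorder)
    also have "\<dots> = 1/4 * (V \<bullet> (ones_mat - rank_one y))"
      unfolding inner_ones_minus[OF sym[OF VW] R] by (simp add: rank_one_def)
    also have "\<dots> = sdp_objective \<W> (rank_one y)"
      unfolding sdp_objective_def by (rule cINF_eq_arg_min[OF V, symmetric])
    also have "\<dots> \<le> sdp_objective \<W> Yhat"
      using Yhat feas by (simp add: is_arg_max_linorder)
    finally show ?thesis .
  qed
  have ge: "0.878 * val_RP \<W> \<le> (\<integral>r. cut_value W (gw_round U r) \<partial>uniform_sphere)" if W: "W \<in> \<W>" for W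
  proof -
    obtain V where V: "is_arg_min (\<lambda>W. 1/4 * (W \<bullet> (ones_mat - Yhat))) (\<lambda>W. W \<in> \<W>) V"
      using attained_SDP[OF Y] by blast
    have "sdp_objective \<W> Yhat \<le> 1/4 * (W \<bullet> (ones_mat - Yhat))"
      unfolding sdp_objective_def cINF_eq_arg_min[OF V] using V W by (simp add: is_arg_min_linorder)
    with relaxation expected_cut_value_ge[OF sym[OF W] nonneg[OF W] Y U] show ?thesis
      by simp
  qed
  have le: "(\<integral>r. cut_value (What' r) (gw_round U r) \<partial>uniform_sphere) \<le> val_RP \<W>"
    if What': "\<forall>r\<in>sphere 0 1. is_arg_min (\<lambda>W. cut_value W (gw_round U r)) (\<lambda>W. W \<in> \<W>) (What' r)"
    for What' :: "real^'n::{finite,wellorder} \<Rightarrow> real^'n::{finite,wellorder}^'n::{finite,wellorder}"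
  proof -
    interpret prob_space "uniform_sphere :: (real^'n::{finite,wellorder}) measure"
      by (rule prob_space_uniform_sphere)
    \<comment> \<open>The rounded vector is itself a sign vector, so its worst-case cut is among the
      values over which the robust maximum is taken.\<close>
    have "cut_value (What' r) (gw_round U r) \<le> val_RP \<W>" if r: "r \<in> space uniform_sphere" for r
    proof -
      have "is_arg_min (?g (gw_round U r)) (\<lambda>W. W \<in> \<W>) (What' r)"
        using What' r by (simp add: space_uniform_sphere is_arg_min_linorder cut)
      hence "cut_value (What' r) (gw_round U r) = 1/2 * ?m (gw_round U r)"
        unfolding cut by (simp add: cINF_eq_arg_min)
      also have "?m (gw_round U r) \<le> Max (?m ` sign_vectors)"
        by (intro Max_ge) (auto simp: finite_sign_vectors gw_round_in_sign_vectors)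
      finally show ?thesis
        by (simp add: val_RP_def)
    qed
    hence "(\<integral>r. cut_value (What' r) (gw_round U r) \<partial>uniform_sphere)
        \<le> (\<integral>r. val_RP \<W> \<partial>(uniform_sphere :: (real^'n::{finite,wellorder}) measure))"
      using integrable_worst_case_cut_value[OF What'] by (intro integral_mono) auto
    thus ?thesis
      by (simp add: prob_space)
  qed
  have "What \<in> \<W>"
    using What by (simp add: is_arg_min_linorder)
  with ge le show ?thesis
    by blast
qed

end
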